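(* Let $K$ be a finite group of order $v$, and let $P \subseteq K$ with $1 \notin P$ be a $(v,k,\beta-1,\beta)$ partial sum set in $K$. Let $G = K \times \{1,z\}$ where $\{1,z\}$ is a cyclic group of order $2$, and set $S = P \cup Pz$ (with $Pz = \{pz : p \in P\}$). Then $S$ is a $(2v,2k,2\beta-2,2\beta)$ partial sum set in $G$ if and only if $|P \cap P^{(-1)}| = \beta$. Consequently, when $|P \cap P^{(-1)}| = \beta$, both $S \cup \{1\}$ and $S \cup \{z\}$ are $(2v,2k+1,2\beta)$ sum sets in $G$ which are type 2 with respect to $N = \{1,z\}$.
   Context: For a finite group $X$ of order $w$, a subset $T \subseteq X$ with $|T| = k$ and $a \in X$, the number of ways to write $a$ as a product in $T$ is the number of ordered pairs $(x,y)\in T\times T$ with $xy=a$. $T$ is a $(w,k,\lambda,\mu)$ partial sum set if every nonidentity element of $T$ is a product in $T$ in exactly $\lambda$ ways and every nonidentity element of $X\setminus T$ is a product in $T$ in exactly $\mu$ ways; if $\lambda=\mu$, $T$ is a $(w,k,\mu)$ sum set. $P^{(-1)} = \{p^{-1}: p\in P\}$. For a normal subgroup $N$ of order $2$, a sum set $T$ is type 2 with respect to $N$ if $|T\cap N| = 1$ and $T$ meets each other coset of $N$ in $0$ or $2$ elements. *)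

theory Defs
  imports "HOL-Algebra.Coset"
begin

definition product_ways :: "('a, 'm) monoid_scheme \<Rightarrow> 'a set \<Rightarrow> 'a \<Rightarrow> nat" where
  "product_ways X T a = card {(x, y). x \<in> T \<and> y \<in> T \<and> x \<otimes>\<^bsub>X\<^esub> y = a}"

(* The parameters lam and mu are integers so that the index beta - 1 is honest subtraction
   (for instance when beta = 0, which occurs for the empty set). *)
definition partial_sum_set ::
    "('a, 'm) monoid_scheme \<Rightarrow> 'a set \<Rightarrow> nat \<Rightarrow> nat \<Rightarrow> int \<Rightarrow> int \<Rightarrow> bool" where
  "partial_sum_set X T w k lam mu \<longleftrightarrow>
     group X \<and> finite (carrier X) \<and> order X = w \<and> T \<subseteq> carrier X \<and> card T = k \<and>
     (\<forall>a \<in> T - {\<one>\<^bsub>X\<^esub>}. int (product_ways X T a) = lam) \<and>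
     (\<forall>a \<in> carrier X - T - {\<one>\<^bsub>X\<^esub>}. int (product_ways X T a) = mu)"

definition sum_set :: "('a, 'm) monoid_scheme \<Rightarrow> 'a set \<Rightarrow> nat \<Rightarrow> nat \<Rightarrow> int \<Rightarrow> bool" where
  "sum_set X T w k mu \<longleftrightarrow> partial_sum_set X T w k mu mu"

definition type2_wrt :: "('a, 'm) monoid_scheme \<Rightarrow> 'a set \<Rightarrow> 'a set \<Rightarrow> bool" where
  "type2_wrt X N T \<longleftrightarrow>
     N \<lhd> X \<and> card N = 2 \<and> (\<exists>w k mu. sum_set X T w k mu) \<and>
     card (T \<inter> N) = 1 \<and>
     (\<forall>c \<in> rcosets\<^bsub>X\<^esub> N. c \<noteq> N \<longrightarrow> card (T \<inter> c) = 0 \<or> card (T \<inter> c) = 2)"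

end

theory Submission
  imports Defs
begin

text \<open>
  Here \<open>S = P \<times> C\<close>, and the second components contribute a free factor of \<open>2\<close>, so \<open>(a, c)\<close> is a
  product in \<open>S\<close> in twice as many ways as \<open>a\<close> is a product in \<open>P\<close>. The hypothesis on \<open>P\<close> settles
  every \<open>a \<noteq> \<one>\<close>; the only nonidentity element left is \<open>(\<one>, z)\<close>, which lies outside \<open>S\<close> and is
  a product in \<open>2 * card (P \<inter> set_inv P)\<close> ways. Adjoining to \<open>S\<close> an element \<open>t \<notin> S\<close> that squares to
  \<open>\<one>\<close>, commutes with \<open>S\<close> and maps \<open>S\<close> into itself adds exactly the products
  \<open>t \<cdot> (t g) = (t g) \<cdot> t = g\<close> for \<open>g \<in> S\<close>, which makes up the difference \<open>\<mu> - \<lambda> = 2\<close>.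
\<close>

text \<open>A pair with product \<open>\<one>\<close> is determined by its first entry
  \<open>x\<close>, the second being \<open>inv x\<close>; it lies in \<open>P\<close> exactly when
  \<open>x\<close> is the inverse of an element of \<open>P\<close>.\<close>

lemma (in group) product_ways_one:
  assumes "P \<subseteq> carrier G"
  shows "product_ways G P \<one> = card (P \<inter> set_inv P)"
proof -
  have "{(x, y). x \<in> P \<and> y \<in> P \<and> x \<otimes> y = \<one>} = (\<lambda>x. (x, inv x)) ` (P \<inter> set_inv P)"
  proof (intro Set.set_eqI iffI)
    fix w assume "w \<in> {(x, y). x \<in> P \<and> y \<in> P \<and> x \<otimes> y = \<one>}"
    then obtain x y where w: "w = (x, y)" "x \<in> P" "y \<in> P" "x \<otimes> y = \<one>"
      by blast
    have "x = inv y"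
      using w assms by (metis inv_equality subsetD)
    moreover have "y = inv x"
      using w assms calculation by (metis inv_inv subsetD)
    ultimately show "w \<in> (\<lambda>x. (x, inv x)) ` (P \<inter> set_inv P)"
      using w by (auto simp: SET_INV_def)
  next
    fix w assume "w \<in> (\<lambda>x. (x, inv x)) ` (P \<inter> set_inv P)"
    then obtain x y where "w = (x, inv x)" "x \<in> P" "y \<in> P" "x = inv y"
      by (auto simp: SET_INV_def)
    then show "w \<in> {(x, y). x \<in> P \<and> y \<in> P \<and> x \<otimes> y = \<one>}"
      using assms by auto
  qed
  moreover have "inj_on (\<lambda>x. (x, inv x)) (P \<inter> set_inv P)"
    by (auto intro: inj_onI)
  ultimately show ?thesis
    by (simp add: product_ways_def card_image)
qed

lemma product_ways_DirProd_carrier: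
  assumes "group C" and c: "c \<in> carrier C"
  shows "product_ways (K \<times>\<times> C) (P \<times> carrier C) (a, c) = product_ways K P a * order C"
proof -
  interpret C: group C by fact
  let ?A = "{(x, y). x \<in> P \<and> y \<in> P \<and> x \<otimes>\<^bsub>K\<^esub> y = a}"
  let ?B = "{(g, h). g \<in> P \<times> carrier C \<and> h \<in> P \<times> carrier C \<and> g \<otimes>\<^bsub>K \<times>\<times> C\<^esub> h = (a, c)}"
  \<comment> \<open>The component \<open>d\<close> of the left factor is free; that of the right
    factor must then solve \<open>d \<otimes> e = c\<close>.\<close>
  let ?f = "\<lambda>((x, y), d). ((x, d), (y, inv\<^bsub>C\<^esub> d \<otimes>\<^bsub>C\<^esub> c))"
  have "?B = ?f ` (?A \<times> carrier C)"
  proof (intro Set.set_eqI iffI)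
    fix w assume "w \<in> ?B"
    then obtain x d y e where w: "w = ((x, d), (y, e))" "x \<in> P" "y \<in> P" "x \<otimes>\<^bsub>K\<^esub> y = a"
      "d \<in> carrier C" "e \<in> carrier C" "d \<otimes>\<^bsub>C\<^esub> e = c"
      by (auto simp: DirProd_def)
    then have "w = ?f ((x, y), d)"
      using C.inv_solve_left by auto
    with w show "w \<in> ?f ` (?A \<times> carrier C)"
      by blast
  next
    fix w assume "w \<in> ?f ` (?A \<times> carrier C)"
    then show "w \<in> ?B"
      using c by (auto simp: DirProd_def C.m_assoc[symmetric])
  qed
  moreover have "inj_on ?f (?A \<times> carrier C)"
    by (auto intro: inj_onI)
  ultimately show ?thesis
    by (simp add: product_ways_def card_image card_cartesian_product order_def)
qed

text \<open>The case \<open>t = \<one>\<close> is included, so that the identity can be adjoined by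
  the same argument as \<open>z\<close>.\<close>

lemma (in group) product_ways_insert_involution:
  assumes "finite S" "S \<subseteq> carrier G" "t \<in> carrier G" "t \<notin> S" "t \<otimes> t = \<one>"
    and comm: "\<And>s. s \<in> S \<Longrightarrow> s \<otimes> t = t \<otimes> s"
    and closed: "\<And>s. s \<in> S \<Longrightarrow> t \<otimes> s \<in> S"
    and g: "g \<in> carrier G" "g \<noteq> \<one>"
  shows "product_ways G (insert t S) g = product_ways G S g + (if g \<in> S then 2 else 0)"
proof -
  let ?A = "{(x, y). x \<in> S \<and> y \<in> S \<and> x \<otimes> y = g}"
  let ?B = "{(x, y). x \<in> insert t S \<and> y \<in> insert t S \<and> x \<otimes> y = g}"
  have tt: "t \<otimes> (t \<otimes> s) = s" if "s \<in> carrier G" for s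
    using that assms by (simp add: m_assoc[symmetric])
  have B: "?B = ?A \<union> (if g \<in> S then {(t, t \<otimes> g), (t \<otimes> g, t)} else {})"
  proof (intro Set.set_eqI iffI)
    fix w assume "w \<in> ?B"
    then obtain x y where w: "w = (x, y)" "x \<in> insert t S" "y \<in> insert t S" "x \<otimes> y = g"
      by blast
    \<comment> \<open>The pair \<open>(t, t)\<close> drops out: its product is
      \<open>\<one>\<close>, whereas \<open>g \<noteq> \<one>\<close>.\<close>
    then consider "x = t" "y \<in> S" | "x \<in> S" "y = t" | "x \<in> S" "y \<in> S"
      using assms by auto
    then show "w \<in> ?A \<union> (if g \<in> S then {(t, t \<otimes> g), (t \<otimes> g, t)} else {})"
    proof cases
      case 1
      then have "g \<in> S" "y = t \<otimes> g"
        using w closed tt[of y] assms(2) by auto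
      with 1 w show ?thesis by simp
    next
      case 2
      then have "g = t \<otimes> x"
        using w comm by simp
      with 2 have "g \<in> S" "x = t \<otimes> g"
        using closed tt[of x] assms(2) by auto
      with 2 w show ?thesis by simp
    qed (use w in simp)
  next
    fix w assume "w \<in> ?A \<union> (if g \<in> S then {(t, t \<otimes> g), (t \<otimes> g, t)} else {})"
    then show "w \<in> ?B"
      using closed comm[OF closed] tt[OF g(1)] by (auto split: if_splits)
  qed
  have fin: "finite ?A"
    by (rule finite_subset[of _ "S \<times> S"]) (use assms(1) in auto)
  show ?thesis
  proof (cases "g \<in> S")
    case True
    \<comment> \<open>Since \<open>t \<otimes> g\<close> lies in \<open>S\<close> and
      \<open>t\<close> does not, the two new pairs are distinct and the increment is 2, not
      1.\<close>
    have ne: "t \<noteq> t \<otimes> g"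
      using closed[OF True] assms(4) by auto
    have "card ?B = card ?A + card {(t, t \<otimes> g), (t \<otimes> g, t)}"
      unfolding B using True fin assms(4) by (subst card_Un_disjoint[symmetric]) auto
    then show ?thesis
      using True ne by (simp add: product_ways_def)
  next
    case False
    then show ?thesis
      unfolding product_ways_def B by simp
  qed
qed

text \<open>The increment lifts the elements of \<open>S\<close> from \<open>\<mu> - 2\<close> to
  \<open>\<mu>\<close> and leaves the others at \<open>\<mu>\<close>. The element \<open>t\<close>
  causes no exception: lying outside \<open>S\<close>, it has count \<open>\<mu>\<close> already
  unless it is the identity.\<close>

lemma (in group) sum_set_insert_involution:
  assumes S: "partial_sum_set G S w k (\<mu> - 2) \<mu>"
    and t: "t \<in> carrier G" "t \<notin> S" "t \<otimes> t = \<one>"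
    and comm: "\<And>s. s \<in> S \<Longrightarrow> s \<otimes> t = t \<otimes> s"
    and closed: "\<And>s. s \<in> S \<Longrightarrow> t \<otimes> s \<in> S"
  shows "sum_set G (insert t S) w (k + 1) \<mu>"
proof -
  have sub: "S \<subseteq> carrier G" and fin: "finite S"
    using S by (auto simp: partial_sum_set_def intro: finite_subset)
  have "int (product_ways G (insert t S) g) = \<mu>" if g: "g \<in> carrier G" "g \<noteq> \<one>" for g
    using product_ways_insert_involution[OF fin sub t _ _ g] comm closed S g
    by (auto simp: partial_sum_set_def)
  then show ?thesis
    using S sub fin t by (auto simp: sum_set_def partial_sum_set_def)
qed

lemma partial_sum_set_DirProd_carrier_iff:
  assumes P: "partial_sum_set K P v k (\<beta> - 1) \<beta>" and one: "\<one>\<^bsub>K\<^esub> \<notin> P"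
    and C: "group C" "order C = 2"
  shows "partial_sum_set (K \<times>\<times> C) (P \<times> carrier C) (2 * v) (2 * k) (2 * \<beta> - 2) (2 * \<beta>)
    \<longleftrightarrow> int (card (P \<inter> set_inv\<^bsub>K\<^esub> P)) = \<beta>"
proof -
  interpret K: group K using P by (simp add: partial_sum_set_def)
  interpret C: group C by fact
  have sub: "P \<subseteq> carrier K"
    using P by (simp add: partial_sum_set_def)
  have fin: "finite (carrier C)"
    using C(2) by (simp add: order_def card_ge_0_finite)
  obtain c where c: "c \<in> carrier C" "c \<noteq> \<one>\<^bsub>C\<^esub>"
  proof -
    have "\<not> carrier C \<subseteq> {\<one>\<^bsub>C\<^esub>}"
      using C(2) card_mono[of "{\<one>\<^bsub>C\<^esub>}" "carrier C"] by (auto simp: order_def)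
    then show ?thesis
      using that by blast
  qed
  have ways: "product_ways (K \<times>\<times> C) (P \<times> carrier C) (a, d) = 2 * product_ways K P a"
    if "d \<in> carrier C" for a d
    using product_ways_DirProd_carrier[OF C(1) that] C(2) by (metis mult.commute)
  show ?thesis
  proof
    assume "partial_sum_set (K \<times>\<times> C) (P \<times> carrier C) (2 * v) (2 * k) (2 * \<beta> - 2) (2 * \<beta>)"
    \<comment> \<open>This element turns the count at \<open>\<one>\<close> in \<open>K\<close>, on
      which the hypothesis on \<open>P\<close> is silent, into a count at a nonidentity element of
      the product.\<close>
    moreover have "(\<one>\<^bsub>K\<^esub>, c) \<in> carrier (K \<times>\<times> C) - P \<times> carrier C - {\<one>\<^bsub>K \<times>\<times> C\<^esub>}"
      using c one by simp
    ultimately have "int (product_ways (K \<times>\<times> C) (P \<times> carrier C) (\<one>\<^bsub>K\<^esub>, c)) = 2 * \<beta>"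
      by (simp add: partial_sum_set_def del: mem_Sigma_iff)
    then show "int (card (P \<inter> set_inv\<^bsub>K\<^esub> P)) = \<beta>"
      using ways c K.product_ways_one[OF sub] by simp
  next
    assume \<beta>: "int (card (P \<inter> set_inv\<^bsub>K\<^esub> P)) = \<beta>"
    have in_P: "int (product_ways K P a) = \<beta> - 1" if "a \<in> P" for a
      using P one that by (auto simp: partial_sum_set_def)
    \<comment> \<open>At \<open>a = \<one>\<close> the value comes from the assumed cardinality,
      elsewhere from the partial sum set property of \<open>P\<close>.\<close>
    have not_in_P: "int (product_ways K P a) = \<beta>" if "a \<in> carrier K" "a \<notin> P" for a
      using P that \<beta> K.product_ways_one[OF sub] by (cases "a = \<one>\<^bsub>K\<^esub>") (auto simp: partial_sum_set_def)
    have "int (product_ways (K \<times>\<times> C) (P \<times> carrier C) g) = 2 * \<beta> - 2" if "g \<in> P \<times> carrier C" for g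
      using that in_P[of "fst g"] ways[of "snd g" "fst g"] by auto
    moreover have "int (product_ways (K \<times>\<times> C) (P \<times> carrier C) g) = 2 * \<beta>"
      if "g \<in> carrier (K \<times>\<times> C) - P \<times> carrier C" for g
    proof -
      have "fst g \<in> carrier K" "fst g \<notin> P" "snd g \<in> carrier C"
        using that by (auto simp: mem_Times_iff)
      then show ?thesis
        using not_in_P ways[of "snd g" "fst g"] by simp
    qed
    ultimately show "partial_sum_set (K \<times>\<times> C) (P \<times> carrier C) (2 * v) (2 * k) (2 * \<beta> - 2) (2 * \<beta>)"
      using P fin sub C DirProd_group[OF K.is_group C(1)]
      by (auto simp: partial_sum_set_def order_def card_cartesian_product)
  qed
qed

text \<open>The cosets of \<open>{\<one>} \<times> carrier C\<close> are the fibres of the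
  projection to \<open>K\<close>. The set \<open>P \<times> carrier C\<close> is a union of fibres
  that avoids the one over \<open>\<one>\<close>, where the adjoined element sits alone.\<close>

lemma type2_wrt_DirProd_carrier:
  assumes "group K" "group C" "order C = 2" "\<one>\<^bsub>K\<^esub> \<notin> P" "d \<in> carrier C"
    and sum: "sum_set (K \<times>\<times> C) (insert (\<one>\<^bsub>K\<^esub>, d) (P \<times> carrier C)) w k \<mu>"
  shows "type2_wrt (K \<times>\<times> C) ({\<one>\<^bsub>K\<^esub>} \<times> carrier C) (insert (\<one>\<^bsub>K\<^esub>, d) (P \<times> carrier C))"
proof -
  interpret K: group K by fact
  interpret C: group C by fact
  let ?N = "{\<one>\<^bsub>K\<^esub>} \<times> carrier C" and ?T = "insert (\<one>\<^bsub>K\<^esub>, d) (P \<times> carrier C)"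
  have normal: "?N \<lhd> K \<times>\<times> C"
    using K.DirProd_normal[OF C.is_group K.one_is_normal] C.normal_invI[OF C.subgroup_self] by simp
  have inter: "?T \<inter> ?N = {(\<one>\<^bsub>K\<^esub>, d)}"
    using assms by auto
  have cosets: "card (?T \<inter> c) = 0 \<or> card (?T \<inter> c) = 2"
    if c: "c \<in> rcosets\<^bsub>K \<times>\<times> C\<^esub> ?N" "c \<noteq> ?N" for c
  proof -
    obtain a e where a: "a \<in> carrier K" "e \<in> carrier C" "c = ?N #>\<^bsub>K \<times>\<times> C\<^esub> (a, e)"
      using c by (auto simp: RCOSETS_def)
    \<comment> \<open>Translation by \<open>e\<close> is absorbed, so the coset depends on
      \<open>a\<close> only.\<close>
    have "carrier C #>\<^bsub>C\<^esub> e = carrier C"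
      using a(2) by (simp add: C.coset_join2 C.subgroup_self)
    then have c': "c = {a} \<times> carrier C"
      using a by (fastforce simp: r_coset_def)
    then have "a \<noteq> \<one>\<^bsub>K\<^esub>"
      using c by auto
    \<comment> \<open>Because \<open>a \<noteq> \<one>\<close>, the adjoined element
      \<open>(\<one>, d)\<close> is not in \<open>c\<close>.\<close>
    then have "?T \<inter> c = (if a \<in> P then {a} \<times> carrier C else {})"
      using c' by auto
    then show ?thesis
      using assms by (simp add: card_cartesian_product order_def)
  qed
  show ?thesis
    unfolding type2_wrt_def inter using normal cosets sum assms(3)
    by (auto simp: card_cartesian_product order_def)
qed

theorem theorem5p3:
  fixes K :: "('a, 'm) monoid_scheme" and C :: "('b, 'n) monoid_scheme"
    and G :: "('a \<times> 'b) monoid"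
    and P :: "'a set" and z :: 'b and S N :: "('a \<times> 'b) set" and zG :: "'a \<times> 'b"
    and v k :: nat and \<beta> :: int
  assumes "group K" and "finite (carrier K)" and "order K = v"
    and "P \<subseteq> carrier K" and "\<one>\<^bsub>K\<^esub> \<notin> P"
    and "partial_sum_set K P v k (\<beta> - 1) \<beta>"
    and "group C" and "carrier C = {\<one>\<^bsub>C\<^esub>, z}" and "z \<noteq> \<one>\<^bsub>C\<^esub>"
    and "G = K \<times>\<times> C"
    and "zG = (\<one>\<^bsub>K\<^esub>, z)"
    and "S = (P \<times> {\<one>\<^bsub>C\<^esub>}) \<union> ((P \<times> {\<one>\<^bsub>C\<^esub>}) #>\<^bsub>G\<^esub> zG)"
    and "N = {\<one>\<^bsub>G\<^esub>, zG}"
  shows "(partial_sum_set G S (2 * v) (2 * k) (2 * \<beta> - 2) (2 * \<beta>)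
            \<longleftrightarrow> int (card (P \<inter> set_inv\<^bsub>K\<^esub> P)) = \<beta>) \<and>
         (int (card (P \<inter> set_inv\<^bsub>K\<^esub> P)) = \<beta> \<longrightarrow>
            sum_set G (S \<union> {\<one>\<^bsub>G\<^esub>}) (2 * v) (2 * k + 1) (2 * \<beta>) \<and>
            type2_wrt G N (S \<union> {\<one>\<^bsub>G\<^esub>}) \<and>
            sum_set G (S \<union> {zG}) (2 * v) (2 * k + 1) (2 * \<beta>) \<and>
            type2_wrt G N (S \<union> {zG}))"
proof -
  interpret K: group K by fact
  interpret C: group C by fact
  interpret G: group "K \<times>\<times> C"
    using DirProd_group assms by blast
  have z: "z \<in> carrier C"
    using assms(8) by simp
  \<comment> \<open>The only other value, \<open>z\<close>, would give \<open>z = \<one>\<close> by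
    cancellation.\<close>
  have zz: "z \<otimes>\<^bsub>C\<^esub> z = \<one>\<^bsub>C\<^esub>"
    using C.m_closed[OF z z] assms(8,9) z by auto
  have order_C: "order C = 2"
    using assms(8,9) by (auto simp: order_def)
  have P_K: "x \<in> carrier K" if "x \<in> P" for x
    using that assms(4) by blast
  \<comment> \<open>Translation by \<open>zG\<close> moves the layer
    \<open>P \<times> {\<one>}\<close> to \<open>P \<times> {z}\<close>, and the two layers fill
    \<open>P \<times> carrier C\<close>.\<close>
  have S: "S = P \<times> carrier C"
    unfolding assms(8,10,11,12) using z P_K by (auto simp: r_coset_def)
  have N: "N = {\<one>\<^bsub>K\<^esub>} \<times> carrier C"
    unfolding assms(8,10,11,13) by auto
  have iff: "partial_sum_set G S (2 * v) (2 * k) (2 * \<beta> - 2) (2 * \<beta>)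
      \<longleftrightarrow> int (card (P \<inter> set_inv\<^bsub>K\<^esub> P)) = \<beta>"
    unfolding S assms(10)
    using partial_sum_set_DirProd_carrier_iff[OF assms(6,5,7) order_C] .
  \<comment> \<open>An arbitrary \<open>d\<close> handles both sets at once:
    \<open>d = \<one>\<close> adjoins the identity of \<open>G\<close>, and \<open>d = z\<close>
    adjoins \<open>zG\<close>.\<close>
  have "sum_set G (insert (\<one>\<^bsub>K\<^esub>, d) S) (2 * v) (2 * k + 1) (2 * \<beta>) \<and>
      type2_wrt G N (insert (\<one>\<^bsub>K\<^esub>, d) S)"
    if "int (card (P \<inter> set_inv\<^bsub>K\<^esub> P)) = \<beta>" and d: "d \<in> carrier C" for d
  proof -
    have dd: "d \<otimes>\<^bsub>C\<^esub> d = \<one>\<^bsub>C\<^esub>"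
      using d zz assms(8) by auto
    have comm: "c \<otimes>\<^bsub>C\<^esub> d = d \<otimes>\<^bsub>C\<^esub> c" if "c \<in> carrier C" for c
      using that d z assms(8) by auto
    have "sum_set (K \<times>\<times> C) (insert (\<one>\<^bsub>K\<^esub>, d) S) (2 * v) (2 * k + 1) (2 * \<beta>)"
    proof (rule G.sum_set_insert_involution)
      show "partial_sum_set (K \<times>\<times> C) S (2 * v) (2 * k) (2 * \<beta> - 2) (2 * \<beta>)"
        using iff that assms(10) by simp
    next
      fix s assume "s \<in> S"
      then obtain p c where s: "s = (p, c)" "p \<in> P" "c \<in> carrier C"
        unfolding S by blast
      then show "s \<otimes>\<^bsub>K \<times>\<times> C\<^esub> (\<one>\<^bsub>K\<^esub>, d) = (\<one>\<^bsub>K\<^esub>, d) \<otimes>\<^bsub>K \<times>\<times> C\<^esub> s"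
        using P_K[of p] comm[of c] by simp
      show "(\<one>\<^bsub>K\<^esub>, d) \<otimes>\<^bsub>K \<times>\<times> C\<^esub> s \<in> S"
        unfolding S using s P_K[of p] d by simp
    qed (use d dd assms(5) in \<open>simp_all add: S\<close>)
    then show ?thesis
      using type2_wrt_DirProd_carrier[OF assms(1,7) order_C assms(5) d]
      unfolding S N assms(10) by simp
  qed
  from this[OF _ C.one_closed] this[OF _ z] show ?thesis
    using iff unfolding assms(10,11) by simp
qed

end
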